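(* Let $E$ be a de Branges function which corresponds to a Schroedinger equation on $[0,1]$ with $L^2$ potential. Then there exists $C>0$ such that the logarithmic strip $$\Big\{z\in\mathbb{C}^-:\ -\frac12\log(|\operatorname{Re} z|+2)+C\le \operatorname{Im} z<0\Big\}$$ contains only a finite number of zeros of $E$.
   Context: $\mathbb{C}^-=\{z:\operatorname{Im} z<0\}$ and $\mathbb{C}_+=\{z:\operatorname{Im} z>0\}$. A de Branges (Hermite–Biehler) function is an entire function $E$ with $|E(z)|>|E(\bar z)|$ for all $z\in\mathbb{C}_+$ and $E\neq 0$ on $\mathbb{R}$ (so all its zeros lie in $\mathbb{C}^-$). Schroedinger equation: $-\ddot u+qu=zu$ on $[0,1]$ with real potential $q$. For $z\in\mathbb{C}$ let $u_z(t)$ be the solution with $u_z(0)=0$, $\dot u_z(0)=1$. A de Branges function $E$ corresponds to the Schroedinger equation with potential $q$ if $E(z)=z\,u_{z^2}(1)+i\,\dot u_{z^2}(1)$. Here $q\in L^2([0,1])$. Standing assumption: $q$ is such that the operators $-\frac{d^2}{dt^2}+q$ on $[0,1]$ with boundary conditions $u(0)=u(1)=0$ and with boundary conditions $u(0)=\dot u(1)=0$ are both positive (all eigenvalues are positive). *)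

theory Defs
  imports "HOL-Analysis.Analysis"
begin

definition hermite_biehler :: "(complex \<Rightarrow> complex) \<Rightarrow> bool" where
  "hermite_biehler E \<longleftrightarrow>
     E holomorphic_on UNIV \<and>
     (\<forall>z. Im z > 0 \<longrightarrow> cmod (E z) > cmod (E (cnj z))) \<and>
     (\<forall>x::real. E (of_real x) \<noteq> 0)"

definition L2_potential :: "(real \<Rightarrow> real) \<Rightarrow> bool" where
  "L2_potential q \<longleftrightarrow>
     q \<in> borel_measurable (lebesgue_on {0..1}) \<and>
     integrable (lebesgue_on {0..1}) (\<lambda>t. (q t)\<^sup>2)"

text \<open>
  Absolute continuity of a function of a real variable. A division consists of finitely many
  non-overlapping compact intervals \<open>K = {Inf K..Sup K}\<close>; degenerate intervals are allowed
  and contribute zero to both sums.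
\<close>

definition abs_continuous_on :: "real set \<Rightarrow> (real \<Rightarrow> complex) \<Rightarrow> bool" where
  "abs_continuous_on S f \<longleftrightarrow>
     (\<forall>\<epsilon>>0. \<exists>\<delta>>0. \<forall>\<D> T.
        \<D> division_of T \<and> T \<subseteq> S \<and> (\<Sum>K\<in>\<D>. Sup K - Inf K) < \<delta> \<longrightarrow>
        (\<Sum>K\<in>\<D>. cmod (f (Sup K) - f (Inf K))) < \<epsilon>)"

text \<open>
  \<open>u\<close> solves \<open>- u'' + q u = z u\<close> on \<open>[0,1]\<close> in the Caratheodory sense, and \<open>v = u'\<close>.
  Derivatives at the end points are one-sided.
\<close>

definition schroedinger_solution ::
  "(real \<Rightarrow> real) \<Rightarrow> complex \<Rightarrow> (real \<Rightarrow> complex) \<Rightarrow> (real \<Rightarrow> complex) \<Rightarrow> bool" where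
  "schroedinger_solution q z u v \<longleftrightarrow>
     (\<forall>t\<in>{0..1}. (u has_vector_derivative v t) (at t within {0..1})) \<and>
     abs_continuous_on {0..1} v \<and>
     (AE t in lebesgue_on {0..1}.
        \<exists>w. (v has_vector_derivative w) (at t within {0..1}) \<and>
            - w + of_real (q t) * u t = z * u t)"

text \<open>
  \<open>B\<close> is the boundary condition, as a predicate on \<open>u\<close> and \<open>u'\<close>. For a solution \<open>u\<close>, both \<open>u\<close> and
  \<open>- u'' + q u = z u\<close> are automatically square integrable, so membership in the \<open>L\<^sup>2\<close> domain of
  the operator imposes nothing further.
\<close>

definition schroedinger_eigenvalue ::
  "(real \<Rightarrow> real) \<Rightarrow> ((real \<Rightarrow> complex) \<Rightarrow> (real \<Rightarrow> complex) \<Rightarrow> bool) \<Rightarrow> complex \<Rightarrow> bool" where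
  "schroedinger_eigenvalue q B z \<longleftrightarrow>
     (\<exists>u v. schroedinger_solution q z u v \<and> B u v \<and> (\<exists>t\<in>{0..1}. u t \<noteq> 0))"

definition positive_schroedinger_operator ::
  "(real \<Rightarrow> real) \<Rightarrow> ((real \<Rightarrow> complex) \<Rightarrow> (real \<Rightarrow> complex) \<Rightarrow> bool) \<Rightarrow> bool" where
  "positive_schroedinger_operator q B \<longleftrightarrow>
     (\<forall>z. schroedinger_eigenvalue q B z \<longrightarrow> z \<in> \<real> \<and> Re z > 0)"

definition dirichlet_dirichlet :: "(real \<Rightarrow> complex) \<Rightarrow> (real \<Rightarrow> complex) \<Rightarrow> bool" where
  "dirichlet_dirichlet u v \<longleftrightarrow> u 0 = 0 \<and> u 1 = 0"

definition dirichlet_neumann :: "(real \<Rightarrow> complex) \<Rightarrow> (real \<Rightarrow> complex) \<Rightarrow> bool" where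
  "dirichlet_neumann u v \<longleftrightarrow> u 0 = 0 \<and> v 1 = 0"

text \<open>
  The initial value problem has exactly one solution on \<open>[0,1]\<close>, so the existential quantifier
  only names it.
\<close>

definition corresponds_to_potential :: "(complex \<Rightarrow> complex) \<Rightarrow> (real \<Rightarrow> real) \<Rightarrow> bool" where
  "corresponds_to_potential E q \<longleftrightarrow>
     (\<forall>z. \<exists>u v. schroedinger_solution q (z\<^sup>2) u v \<and> u 0 = 0 \<and> v 0 = 1 \<and>
                E z = z * u 1 + \<i> * v 1)"

end

theory Submission
  imports Defs "HOL-Complex_Analysis.Conformal_Mappings"
begin

text \<open>
  With \<open>p t = exp (\<i> z t) (u' t - \<i> z u t)\<close> one has \<open>E z = \<i> exp (- \<i> z) p 1\<close>, \<open>p 0 = 1\<close> and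
  \<open>p' = exp (\<i> z t) q u\<close>. Put \<open>Q = \<integral>\<bar>q\<bar>\<close>. In the lower half plane \<open>\<bar>z u t\<bar> \<le> 2 exp (- Im z t)\<close> as soon as
  \<open>\<bar>z\<bar> \<ge> 2 Q\<close>, so that \<open>\<bar>p 1 - 1\<bar> \<le> 2 Q exp (- 2 Im z) / \<bar>z\<bar>\<close> and every zero satisfies
  \<open>\<bar>z\<bar> \<le> 2 Q exp (- 2 Im z)\<close>. In the strip with \<open>exp (2 C) = 4 Q + 2\<close> this confines the zeros to the
  disc \<open>\<bar>z\<bar> \<le> 2\<close>.
\<close>

section \<open>Elementary properties of absolutely continuous functions\<close>

lemma division_of_interval:
  fixes K S :: "real set"
  assumes "\<D> division_of T" "T \<subseteq> S" "K \<in> \<D>"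
  shows "Inf K \<in> S" "Sup K \<in> S" "Inf K \<le> Sup K"
proof -
  obtain a b where K: "K = cbox a b" "K \<noteq> {}" "K \<subseteq> T"
    using division_ofD(2,3,4)[OF assms(1,3)] by blast
  then have "a \<le> b"
    by simp
  then show "Inf K \<in> S" "Sup K \<in> S" "Inf K \<le> Sup K"
    using K assms(2) by auto
qed

lemma abs_continuous_onE:
  assumes "abs_continuous_on S f" "0 < \<epsilon>"
  obtains \<delta> where "0 < \<delta>"
    "\<And>\<D> T. \<D> division_of T \<Longrightarrow> T \<subseteq> S \<Longrightarrow> (\<Sum>K\<in>\<D>. Sup K - Inf K) < \<delta> \<Longrightarrow>
        (\<Sum>K\<in>\<D>. cmod (f (Sup K) - f (Inf K))) < \<epsilon>"
proof -
  have "\<exists>\<delta>>0. \<forall>\<D> T. \<D> division_of T \<and> T \<subseteq> S \<and> (\<Sum>K\<in>\<D>. Sup K - Inf K) < \<delta> \<longrightarrow>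
        (\<Sum>K\<in>\<D>. cmod (f (Sup K) - f (Inf K))) < \<epsilon>"
    using assms(1)[unfolded abs_continuous_on_def, rule_format, OF assms(2)] .
  then show thesis
    using that by blast
qed

lemma abs_continuous_on_subset:
  assumes "abs_continuous_on S f" "S' \<subseteq> S"
  shows "abs_continuous_on S' f"
  unfolding abs_continuous_on_def
proof (intro allI impI)
  fix \<epsilon> :: real
  assume "0 < \<epsilon>"
  from assms(1) this show "\<exists>\<delta>>0. \<forall>\<D> T. \<D> division_of T \<and> T \<subseteq> S' \<and> (\<Sum>K\<in>\<D>. Sup K - Inf K) < \<delta> \<longrightarrow>
        (\<Sum>K\<in>\<D>. cmod (f (Sup K) - f (Inf K))) < \<epsilon>"
    by (rule abs_continuous_onE) (use assms(2) in blast)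
qed

lemma abs_continuous_on_lipschitz:
  assumes "L-lipschitz_on S f"
  shows "abs_continuous_on S f"
  unfolding abs_continuous_on_def
proof (intro allI impI)
  fix \<epsilon> :: real
  assume "0 < \<epsilon>"
  have "0 \<le> L"
    using assms lipschitz_on_nonneg by blast
  show "\<exists>\<delta>>0. \<forall>\<D> T. \<D> division_of T \<and> T \<subseteq> S \<and> (\<Sum>K\<in>\<D>. Sup K - Inf K) < \<delta> \<longrightarrow>
        (\<Sum>K\<in>\<D>. cmod (f (Sup K) - f (Inf K))) < \<epsilon>"
  \<comment> \<open>Dividing by \<open>L + 1\<close> instead of \<open>L\<close> covers the case
    \<open>L = 0\<close> and makes the final inequality strict.\<close>
  proof (intro exI[of _ "\<epsilon> / (L + 1)"] conjI allI impI, goal_cases)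
    case 1
    then show ?case
      using \<open>0 < \<epsilon>\<close> \<open>0 \<le> L\<close> by simp
  next
    case (2 \<D> T)
    then have div: "\<D> division_of T" "T \<subseteq> S" and small: "(\<Sum>K\<in>\<D>. Sup K - Inf K) < \<epsilon> / (L + 1)"
      by auto
    have "(\<Sum>K\<in>\<D>. cmod (f (Sup K) - f (Inf K))) \<le> (\<Sum>K\<in>\<D>. L * (Sup K - Inf K))"
    proof (rule sum_mono)
      fix K assume "K \<in> \<D>"
      note K = division_of_interval[OF div this]
      show "cmod (f (Sup K) - f (Inf K)) \<le> L * (Sup K - Inf K)"
        using lipschitz_onD[OF assms K(2,1)] K(3) by (simp add: dist_norm)
    qed
    also have "\<dots> = L * (\<Sum>K\<in>\<D>. Sup K - Inf K)"
      by (simp add: sum_distrib_left)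
    also have "\<dots> \<le> L * (\<epsilon> / (L + 1))"
      using small \<open>0 \<le> L\<close> by (intro mult_left_mono) auto
    also have "\<dots> < \<epsilon>"
      using \<open>0 < \<epsilon>\<close> \<open>0 \<le> L\<close> by (simp add: field_simps)
    finally show ?case .
  qed
qed

lemma abs_continuous_on_diff:
  assumes "abs_continuous_on S f" "abs_continuous_on S g"
  shows "abs_continuous_on S (\<lambda>x. f x - g x)"
  unfolding abs_continuous_on_def
proof (intro allI impI)
  fix \<epsilon> :: real
  assume "0 < \<epsilon>"
  then have "0 < \<epsilon> / 2"
    by simp
  obtain \<delta>1 where "0 < \<delta>1"
    and f: "\<And>\<D> T. \<D> division_of T \<Longrightarrow> T \<subseteq> S \<Longrightarrow> (\<Sum>K\<in>\<D>. Sup K - Inf K) < \<delta>1 \<Longrightarrow>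
        (\<Sum>K\<in>\<D>. cmod (f (Sup K) - f (Inf K))) < \<epsilon> / 2"
    by (rule abs_continuous_onE[OF assms(1) \<open>0 < \<epsilon> / 2\<close>]) blast
  obtain \<delta>2 where "0 < \<delta>2"
    and g: "\<And>\<D> T. \<D> division_of T \<Longrightarrow> T \<subseteq> S \<Longrightarrow> (\<Sum>K\<in>\<D>. Sup K - Inf K) < \<delta>2 \<Longrightarrow>
        (\<Sum>K\<in>\<D>. cmod (g (Sup K) - g (Inf K))) < \<epsilon> / 2"
    by (rule abs_continuous_onE[OF assms(2) \<open>0 < \<epsilon> / 2\<close>]) blast
  note \<delta> = \<open>0 < \<delta>1\<close> \<open>0 < \<delta>2\<close>
  show "\<exists>\<delta>>0. \<forall>\<D> T. \<D> division_of T \<and> T \<subseteq> S \<and> (\<Sum>K\<in>\<D>. Sup K - Inf K) < \<delta> \<longrightarrow>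
        (\<Sum>K\<in>\<D>. cmod ((f (Sup K) - g (Sup K)) - (f (Inf K) - g (Inf K)))) < \<epsilon>"
  proof (intro exI[of _ "min \<delta>1 \<delta>2"] conjI allI impI, goal_cases)
    case 1
    then show ?case
      using \<delta> by simp
  next
    case (2 \<D> T)
    have "(\<Sum>K\<in>\<D>. cmod ((f (Sup K) - g (Sup K)) - (f (Inf K) - g (Inf K))))
      \<le> (\<Sum>K\<in>\<D>. cmod (f (Sup K) - f (Inf K)) + cmod (g (Sup K) - g (Inf K)))"
    proof (rule sum_mono)
      fix K
      have "(f (Sup K) - g (Sup K)) - (f (Inf K) - g (Inf K))
        = (f (Sup K) - f (Inf K)) - (g (Sup K) - g (Inf K))"
        by simp
      then show "cmod ((f (Sup K) - g (Sup K)) - (f (Inf K) - g (Inf K)))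
        \<le> cmod (f (Sup K) - f (Inf K)) + cmod (g (Sup K) - g (Inf K))"
        by (metis norm_triangle_ineq4)
    qed
    also have "\<dots> < \<epsilon>"
      using f[of \<D> T] g[of \<D> T] 2 by (simp add: sum.distrib)
    finally show ?case .
  qed
qed

text \<open>An increment of the product splits into \<open>g (Sup K)\<close> times an increment of
  \<open>f\<close> plus \<open>f (Inf K)\<close> times an increment of \<open>g\<close>. Boundedness
  is a hypothesis because absolute continuity on an arbitrary \<open>S\<close> does not imply it:
  take the identity on the whole line.\<close>

lemma abs_continuous_on_mult:
  assumes "abs_continuous_on S f" "abs_continuous_on S g"
    and "bounded (f ` S)" "bounded (g ` S)"
  shows "abs_continuous_on S (\<lambda>x. f x * g x)"
  unfolding abs_continuous_on_def
proof (intro allI impI)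
  fix \<epsilon> :: real
  assume "0 < \<epsilon>"
  obtain A B where AB: "0 < A" "\<And>x. x \<in> S \<Longrightarrow> cmod (f x) \<le> A" "0 < B" "\<And>x. x \<in> S \<Longrightarrow> cmod (g x) \<le> B"
    using assms(3,4) unfolding bounded_pos by auto
  have eps: "0 < \<epsilon> / (2 * B)" "0 < \<epsilon> / (2 * A)"
    using \<open>0 < \<epsilon>\<close> AB by auto
  obtain \<delta>1 where "0 < \<delta>1"
    and f: "\<And>\<D> T. \<D> division_of T \<Longrightarrow> T \<subseteq> S \<Longrightarrow> (\<Sum>K\<in>\<D>. Sup K - Inf K) < \<delta>1 \<Longrightarrow>
        (\<Sum>K\<in>\<D>. cmod (f (Sup K) - f (Inf K))) < \<epsilon> / (2 * B)"
    by (rule abs_continuous_onE[OF assms(1) eps(1)]) blast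
  obtain \<delta>2 where "0 < \<delta>2"
    and g: "\<And>\<D> T. \<D> division_of T \<Longrightarrow> T \<subseteq> S \<Longrightarrow> (\<Sum>K\<in>\<D>. Sup K - Inf K) < \<delta>2 \<Longrightarrow>
        (\<Sum>K\<in>\<D>. cmod (g (Sup K) - g (Inf K))) < \<epsilon> / (2 * A)"
    by (rule abs_continuous_onE[OF assms(2) eps(2)]) blast
  note \<delta> = \<open>0 < \<delta>1\<close> \<open>0 < \<delta>2\<close>
  show "\<exists>\<delta>>0. \<forall>\<D> T. \<D> division_of T \<and> T \<subseteq> S \<and> (\<Sum>K\<in>\<D>. Sup K - Inf K) < \<delta> \<longrightarrow>
        (\<Sum>K\<in>\<D>. cmod (f (Sup K) * g (Sup K) - f (Inf K) * g (Inf K))) < \<epsilon>"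
  proof (intro exI[of _ "min \<delta>1 \<delta>2"] conjI allI impI, goal_cases)
    case 1
    then show ?case
      using \<delta> by simp
  next
    case (2 \<D> T)
    then have div: "\<D> division_of T" "T \<subseteq> S"
      by auto
    have "(\<Sum>K\<in>\<D>. cmod (f (Sup K) * g (Sup K) - f (Inf K) * g (Inf K)))
      \<le> (\<Sum>K\<in>\<D>. B * cmod (f (Sup K) - f (Inf K)) + A * cmod (g (Sup K) - g (Inf K)))"
    proof (rule sum_mono)
      fix K assume "K \<in> \<D>"
      note K = division_of_interval[OF div this]
      have "f (Sup K) * g (Sup K) - f (Inf K) * g (Inf K)
        = g (Sup K) * (f (Sup K) - f (Inf K)) + f (Inf K) * (g (Sup K) - g (Inf K))"
        by (simp add: algebra_simps)
      also have "cmod \<dots> \<le> cmod (g (Sup K)) * cmod (f (Sup K) - f (Inf K))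
          + cmod (f (Inf K)) * cmod (g (Sup K) - g (Inf K))"
        by (metis norm_mult norm_triangle_ineq)
      also have "\<dots> \<le> B * cmod (f (Sup K) - f (Inf K)) + A * cmod (g (Sup K) - g (Inf K))"
        using AB K by (intro add_mono mult_right_mono) auto
      finally show "cmod (f (Sup K) * g (Sup K) - f (Inf K) * g (Inf K))
        \<le> B * cmod (f (Sup K) - f (Inf K)) + A * cmod (g (Sup K) - g (Inf K))" .
    qed
    also have "\<dots> = B * (\<Sum>K\<in>\<D>. cmod (f (Sup K) - f (Inf K))) + A * (\<Sum>K\<in>\<D>. cmod (g (Sup K) - g (Inf K)))"
      by (simp add: sum.distrib sum_distrib_left)
    also have "\<dots> < B * (\<epsilon> / (2 * B)) + A * (\<epsilon> / (2 * A))"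
      using f[OF div] g[OF div] 2 AB by (intro add_strict_mono mult_strict_left_mono) auto
    also have "\<dots> = \<epsilon>"
      using AB by (simp add: field_simps)
    finally show ?case .
  qed
qed

lemma abs_continuous_on_imp_continuous_on:
  assumes "abs_continuous_on {a..b} f"
  shows "continuous_on {a..b} f"
  unfolding continuous_on_iff
proof (intro ballI allI impI)
  fix x \<epsilon> :: real
  assume x: "x \<in> {a..b}" and "0 < \<epsilon>"
  obtain \<delta> where "0 < \<delta>"
    and f: "\<And>\<D> T. \<D> division_of T \<Longrightarrow> T \<subseteq> {a..b} \<Longrightarrow> (\<Sum>K\<in>\<D>. Sup K - Inf K) < \<delta> \<Longrightarrow>
        (\<Sum>K\<in>\<D>. cmod (f (Sup K) - f (Inf K))) < \<epsilon>"
    by (rule abs_continuous_onE[OF assms \<open>0 < \<epsilon>\<close>]) blast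
  \<comment> \<open>Absolute continuity is tested on the division whose only interval is
    \<open>{y..y'}\<close>.\<close>
  have close: "dist (f y') (f y) < \<epsilon>"
    if "y \<in> {a..b}" "y' \<in> {a..b}" "y \<le> y'" "y' - y < \<delta>" for y y'
    using f[of "{{y..y'}}" "{y..y'}"] that division_of_self[of y y'] by (simp add: dist_norm)
  show "\<exists>d>0. \<forall>x'\<in>{a..b}. dist x' x < d \<longrightarrow> dist (f x') (f x) < \<epsilon>"
  proof (intro exI[of _ \<delta>] conjI ballI impI)
    fix x' assume x': "x' \<in> {a..b}" "dist x' x < \<delta>"
    show "dist (f x') (f x) < \<epsilon>"
    proof (cases "x \<le> x'")
      case True
      then show ?thesis
        using close[of x x'] x x' by (simp add: dist_real_def)
    next
      case False
      then show ?thesis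
        using close[of x' x] x x' by (simp add: dist_real_def dist_commute)
    qed
  qed (fact \<open>0 < \<delta>\<close>)
qed

section \<open>Absolute continuity and the gauge integral\<close>

text \<open>This carries absolute continuity over from divisions to the tagged partial divisions
  that a gauge produces. The intervals do not overlap, so their total length is the measure of their
  union, which is at most the measure of \<open>U\<close>.\<close>

lemma abs_continuous_on_sum_tagged_small:
  assumes "abs_continuous_on {a..b} f" "0 < \<epsilon>"
  obtains \<delta> where "0 < \<delta>"
    "\<And>p U. p tagged_partial_division_of {a..b} \<Longrightarrow> U \<in> lmeasurable \<Longrightarrow> measure lebesgue U < \<delta> \<Longrightarrow>
      \<Union>(snd ` p) \<subseteq> U \<Longrightarrow> (\<Sum>(x,K)\<in>p. cmod (f (Sup K) - f (Inf K))) < \<epsilon>"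
proof -
  obtain \<delta> where "0 < \<delta>"
    and f: "\<And>\<D> T. \<D> division_of T \<Longrightarrow> T \<subseteq> {a..b} \<Longrightarrow> (\<Sum>K\<in>\<D>. Sup K - Inf K) < \<delta> \<Longrightarrow>
        (\<Sum>K\<in>\<D>. cmod (f (Sup K) - f (Inf K))) < \<epsilon>"
    by (rule abs_continuous_onE[OF assms]) blast
  show thesis
  proof (rule that[OF \<open>0 < \<delta>\<close>])
    fix p U
    assume p: "p tagged_partial_division_of {a..b}" and U: "U \<in> lmeasurable" "measure lebesgue U < \<delta>"
      and sub: "\<Union>(snd ` p) \<subseteq> U"
    let ?T = "\<Union>(snd ` p)"
    have div: "(snd ` p) division_of ?T"
      using division_of_tagged_division[OF tagged_partial_division_of_Union_self[OF p]] .
    have T: "?T \<subseteq> {a..b}"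
      using tagged_partial_division_ofD(3)[OF p] by fastforce
    have "(\<Sum>K\<in>snd ` p. Sup K - Inf K) = (\<Sum>K\<in>snd ` p. measure lebesgue K)"
    proof (rule sum.cong)
      fix K assume K: "K \<in> snd ` p"
      then obtain c d where "K = {c..d}"
        using division_ofD(4)[OF div K] by auto
      then show "Sup K - Inf K = measure lebesgue K"
        using division_ofD(3)[OF div K] by auto
    qed simp
    also have "\<dots> = measure lebesgue ?T"
      by (rule content_division[OF div])
    also have "\<dots> < \<delta>"
      using measure_mono_fmeasurable[OF sub _ U(1)] lmeasurable_division[OF div] U(2) by fastforce
    finally have "(\<Sum>K\<in>snd ` p. cmod (f (Sup K) - f (Inf K))) < \<epsilon>"
      using f[OF div T] by simp
    moreover have "(\<Sum>K\<in>snd ` p. cmod (f (Sup K) - f (Inf K)))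
      = (\<Sum>(x,K)\<in>p. cmod (f (Sup K) - f (Inf K)))"
    \<comment> \<open>Forgetting the tags may identify two elements of \<open>p\<close>. Their
      common interval then has empty interior, so it is a single point and contributes zero to the
      sum.\<close>
    proof (subst sum.reindex_nontrivial)
      show "finite p"
        using tagged_partial_division_ofD(1)[OF p] .
      fix y y' assume y: "y \<in> p" "y' \<in> p" "y \<noteq> y'" "snd y = snd y'"
      obtain x x' K where yK: "y = (x, K)" "y' = (x', K)"
        using y(4) by (cases y, cases y') auto
      then have "interior K = {}" "x \<in> K"
        using tagged_partial_division_ofD(2,5)[OF p] y by blast+
      moreover obtain c d where "K = cbox c d"
        using tagged_partial_division_ofD(4)[OF p] y yK by blast
      ultimately have "K = {x}"
        by auto
      then show "cmod (f (Sup (snd y)) - f (Inf (snd y))) = 0"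
        using yK by simp
    qed (auto simp: case_prod_unfold)
    ultimately show "(\<Sum>(x,K)\<in>p. cmod (f (Sup K) - f (Inf K))) < \<epsilon>"
      by simp
  qed
qed

text \<open>
  The gauge is the usual one off the null set \<open>N\<close>; on \<open>N\<close> it confines the intervals to an open set
  of small measure, where absolute continuity controls the increments of \<open>f\<close>.
\<close>

theorem fundamental_theorem_of_calculus_abs_continuous:
  fixes f :: "real \<Rightarrow> complex"
  assumes "a \<le> b" and ac: "abs_continuous_on {a..b} f" and "negligible N"
    and vecd: "\<And>x. x \<in> {a..b} - N \<Longrightarrow> (f has_vector_derivative f' x) (at x within {a..b})"
  shows "(f' has_integral (f b - f a)) {a..b}"
proof -
  \<comment> \<open>With the integrand set to zero on \<open>N\<close>, an interval tagged in
    \<open>N\<close> contributes only the increment of \<open>f\<close> to the error. Since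
    \<open>N\<close> is negligible, \<open>f'\<close> has the same integral.\<close>
  define g where "g x = (if x \<in> N then 0 else f' x)" for x
  have "(g has_integral (f b - f a)) (cbox a b)"
    unfolding has_integral
  proof (intro allI impI)
    fix e :: real
    assume "0 < e"
    \<comment> \<open>The factor is chosen so that \<open>e' * (b - a) < e / 2\<close>; the summand
      1 keeps the denominator positive when \<open>a = b\<close>.\<close>
    define e' where "e' = e / (2 * (b - a + 1))"
    have "0 < e'"
      using \<open>0 < e\<close> \<open>a \<le> b\<close> by (simp add: e'_def)
    then have "\<forall>x. \<exists>d>0. x \<in> {a..b} - N \<longrightarrow>
         (\<forall>y\<in>{a..b}. norm (y-x) < d \<longrightarrow> norm (f y - f x - (y-x) *\<^sub>R f' x) \<le> e' * norm (y-x))"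
      using vecd[unfolded has_vector_derivative_def has_derivative_within_alt] zero_less_one by blast
    then obtain d where d: "\<And>x. 0 < d x"
      "\<And>x y. \<lbrakk>x \<in> {a..b} - N; y \<in> {a..b}; norm (y-x) < d x\<rbrakk>
                        \<Longrightarrow> norm (f y - f x - (y-x) *\<^sub>R f' x) \<le> e' * norm (y-x)"
      by metis
    obtain \<delta> where "0 < \<delta>"
      and \<delta>: "\<And>p U. p tagged_partial_division_of {a..b} \<Longrightarrow> U \<in> lmeasurable \<Longrightarrow> measure lebesgue U < \<delta> \<Longrightarrow>
      \<Union>(snd ` p) \<subseteq> U \<Longrightarrow> (\<Sum>(x,K)\<in>p. cmod (f (Sup K) - f (Inf K))) < e / 2"
      using abs_continuous_on_sum_tagged_small[OF ac, of "e / 2"] \<open>0 < e\<close> by auto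
    \<comment> \<open>Outer regularity of Lebesgue measure makes \<open>U - N\<close> small; as
      \<open>N\<close> is null, \<open>U\<close> itself has measure below
      \<open>\<delta>\<close>.\<close>
    obtain U where U: "open U" "N \<subseteq> U" "U - N \<in> lmeasurable" "emeasure lebesgue (U - N) < ennreal \<delta>"
      using sets_lebesgue_outer_open[of N \<delta>] negligible_imp_sets[OF \<open>negligible N\<close>] \<open>0 < \<delta>\<close> by blast
    have N: "N \<in> lmeasurable" "measure lebesgue N = 0"
      using \<open>negligible N\<close> by (auto simp: negligible_iff_measure)
    have "U = (U - N) \<union> N"
      using U by auto
    then have Um: "U \<in> lmeasurable"
      using U(3) N(1) by (metis fmeasurable.Un)
    have "measure lebesgue U \<le> measure lebesgue (U - N) + measure lebesgue N"
      using \<open>U = (U - N) \<union> N\<close> U(3) N(1) by (metis fmeasurableD measure_Un_le)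
    moreover have "measure lebesgue (U - N) < \<delta>"
      using U(3,4) \<open>0 < \<delta>\<close> by (simp add: emeasure_eq_measure2 ennreal_less_iff)
    ultimately have Ud: "measure lebesgue U < \<delta>"
      using N by simp
    define \<gamma> where "\<gamma> x = (if x \<in> N then U else ball x (d x))" for x
    show "\<exists>\<gamma>. gauge \<gamma> \<and> (\<forall>p. p tagged_division_of cbox a b \<and> \<gamma> fine p \<longrightarrow>
             norm ((\<Sum>(x,K)\<in>p. measure lborel K *\<^sub>R g x) - (f b - f a)) < e)"
    proof (intro exI[of _ \<gamma>] conjI allI impI)
      show "gauge \<gamma>"
        using U d(1) by (auto simp: gauge_def \<gamma>_def)
      fix p assume "p tagged_division_of cbox a b \<and> \<gamma> fine p"
      then have p: "p tagged_division_of {a..b}" and fine: "\<gamma> fine p"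
        by auto
      have fin: "finite p"
        using p by auto
      define p1 where "p1 = {(x,K) \<in> p. x \<in> N}"
      define p2 where "p2 = {(x,K) \<in> p. x \<notin> N}"
      have p12: "p = p1 \<union> p2" "p1 \<inter> p2 = {}" "p1 \<subseteq> p" "p2 \<subseteq> p"
        by (auto simp: p1_def p2_def)
      \<comment> \<open>\<open>?h\<close> is the error of one term of the Riemann sum. The
        increments of \<open>f\<close> telescope to \<open>f b - f a\<close>, so the sum of
        \<open>?h\<close> over \<open>p\<close> is the total error; the tags in \<open>N\<close> and
        the tags off \<open>N\<close> account for at most half of \<open>e\<close> each.\<close>
      let ?h = "\<lambda>(x,K). measure lborel K *\<^sub>R g x - (f (Sup K) - f (Inf K))"
      have lens: "b - a = (\<Sum>(x,K)\<in>p. Sup K - Inf K)" "f b - f a = (\<Sum>(x,K)\<in>p. f(Sup K) - f(Inf K))"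
        using additive_tagged_division_1[OF \<open>a \<le> b\<close> p, of "\<lambda>x. x"]
          additive_tagged_division_1[OF \<open>a \<le> b\<close> p, of f] by auto
      have "p tagged_partial_division_of {a..b}"
        using p by (simp add: tagged_division_of_def)
      then have "p1 tagged_partial_division_of {a..b}"
        using p12(3) tagged_partial_division_subset by blast
      moreover have "\<Union>(snd ` p1) \<subseteq> U"
        using fine unfolding fine_def p1_def \<gamma>_def by fastforce
      ultimately have small1: "(\<Sum>(x,K)\<in>p1. cmod (f (Sup K) - f (Inf K))) < e / 2"
        using \<delta> Um Ud by blast
      have "norm (sum ?h p1) \<le> (\<Sum>(x,K)\<in>p1. cmod (f (Sup K) - f (Inf K)))"
        by (rule sum_norm_le) (auto simp: p1_def g_def norm_minus_commute)
      also note small1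
      finally have 1: "norm (sum ?h p1) < e / 2" .
      have "norm (sum ?h p2) \<le> (\<Sum>(x,K)\<in>p2. e' * (Sup K - Inf K))"
      proof (rule sum_norm_le, clarify)
        fix x K assume xK: "(x, K) \<in> p2"
        then have xp: "(x, K) \<in> p" and "x \<notin> N"
          by (auto simp: p2_def)
        then obtain u v where K: "K = cbox u v" "x \<in> K" "K \<subseteq> {a..b}"
          using tagged_division_ofD(2,3,4)[OF p] by meson
        have "u \<le> v"
          using K by auto
        have ball: "K \<subseteq> ball x (d x)"
          using fine xp \<open>x \<notin> N\<close> unfolding fine_def \<gamma>_def by fastforce
        have uv: "u \<in> K" "v \<in> K"
          by (simp_all add: \<open>u \<le> v\<close> K)
        \<comment> \<open>Straddle estimate: both end points are compared with the tag
          \<open>x\<close>, the only point where the derivative is controlled. Because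
          \<open>u \<le> x \<le> v\<close>, the two distances add up to
          \<open>v - u\<close>.\<close>
        have "norm ((v - u) *\<^sub>R f' x - (f v - f u)) = norm (f u - f x - (u - x) *\<^sub>R f' x - (f v - f x - (v - x) *\<^sub>R f' x))"
          by (auto simp: algebra_simps)
        also have "\<dots> \<le> norm (f u - f x - (u - x) *\<^sub>R f' x) + norm (f v - f x - (v - x) *\<^sub>R f' x)"
          by (rule norm_triangle_ineq4)
        also have "\<dots> \<le> e' * norm (u - x) + e' * norm (v - x)"
        proof (rule add_mono)
          have "y \<in> {a..b}" "norm (y - x) < d x" if "y \<in> K" for y
            using that K ball by (auto simp: dist_real_def abs_minus_commute)
          moreover have "x \<in> {a..b} - N"
            using K \<open>x \<notin> N\<close> by auto
          ultimately show "norm (f u - f x - (u - x) *\<^sub>R f' x) \<le> e' * norm (u - x)"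
            "norm (f v - f x - (v - x) *\<^sub>R f' x) \<le> e' * norm (v - x)"
            using d(2) uv by blast+
        qed
        also have "\<dots> = e' * (v - u)"
          using K by (auto simp: algebra_simps)
        finally show "norm (measure lborel K *\<^sub>R g x - (f (Sup K) - f (Inf K))) \<le> e' * (Sup K - Inf K)"
          using \<open>u \<le> v\<close> \<open>x \<notin> N\<close> by (simp add: K(1) g_def)
      qed
      also have "\<dots> \<le> (\<Sum>(x,K)\<in>p. e' * (Sup K - Inf K))"
      proof (rule sum_mono2[OF fin p12(4)], clarify)
        fix x K assume "(x, K) \<in> p"
        then obtain u v where "K = cbox u v" "x \<in> K"
          using tagged_division_ofD(2,4)[OF p] by meson
        then show "0 \<le> e' * (Sup K - Inf K)"
          using \<open>0 < e'\<close> by auto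
      qed
      also have "\<dots> = e' * (b - a)"
        by (simp add: lens(1) sum_distrib_left case_prod_unfold)
      also have "\<dots> < e / 2"
        using \<open>0 < e\<close> \<open>a \<le> b\<close> by (simp add: e'_def field_simps)
      finally have 2: "norm (sum ?h p2) < e / 2" .
      have "(\<Sum>(x,K)\<in>p. measure lborel K *\<^sub>R g x) - (f b - f a) = sum ?h p"
        unfolding lens(2) by (simp add: sum_subtractf case_prod_unfold)
      also have "\<dots> = sum ?h p1 + sum ?h p2"
        using sum.union_disjoint[of p1 p2 ?h] p12 fin finite_subset by blast
      also have "norm \<dots> < e"
        using norm_triangle_ineq[of "sum ?h p1" "sum ?h p2"] 1 2 by linarith
      finally show "norm ((\<Sum>(x,K)\<in>p. measure lborel K *\<^sub>R g x) - (f b - f a)) < e" .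
    qed
  qed
  then show ?thesis
    using has_integral_spike[OF \<open>negligible N\<close>, of "{a..b}" f' g] by (simp add: g_def)
qed

text \<open>A continuous derivative is bounded on the compact interval, so \<open>f\<close> is
  Lipschitz. This serves the smooth factors, namely the exponential and the solution
  \<open>u\<close>.\<close>

lemma abs_continuous_on_vector_derivative:
  fixes f :: "real \<Rightarrow> complex"
  assumes vecd: "\<And>x. x \<in> {a..b} \<Longrightarrow> (f has_vector_derivative f' x) (at x within {a..b})"
    and cont: "continuous_on {a..b} f'"
  shows "abs_continuous_on {a..b} f"
proof -
  have "bounded (f' ` {a..b})"
    by (simp add: cont compact_continuous_image compact_imp_bounded)
  then obtain B where B: "0 < B" "\<And>x. x \<in> {a..b} \<Longrightarrow> cmod (f' x) \<le> B"
    unfolding bounded_pos by auto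
  have "B-lipschitz_on {a..b} f"
  proof (rule bounded_derivative_imp_lipschitz)
    show "(f has_derivative (\<lambda>h. h *\<^sub>R f' x)) (at x within {a..b})" if "x \<in> {a..b}" for x
      using vecd[OF that] by (simp add: has_vector_derivative_def)
    show "onorm (\<lambda>h. h *\<^sub>R f' x) \<le> B" if "x \<in> {a..b}" for x
    proof (rule onorm_bound)
      show "norm (h *\<^sub>R f' x) \<le> B * norm h" for h
        using mult_right_mono[OF B(2)[OF that], of "\<bar>h\<bar>"] by (simp add: mult.commute)
    qed (use B in simp)
  qed (use B in auto)
  then show ?thesis
    by (rule abs_continuous_on_lipschitz)
qed

section \<open>Estimates for solutions of the Schroedinger equation\<close>

text \<open>The function \<open>1 + (q t)\<^sup>2\<close> dominates \<open>\<bar>q t\<bar>\<close>,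
  by expanding the square of \<open>\<bar>q t\<bar> - 1\<close>, and it is integrable because the
  interval has finite measure.\<close>

lemma L2_potential_imp_abs_integrable_on:
  assumes "L2_potential q"
  shows "(\<lambda>t. \<bar>q t\<bar>) integrable_on {0..1}"
proof (rule integrable_on_lebesgue_on)
  have q: "q \<in> borel_measurable (lebesgue_on {0..1})" "integrable (lebesgue_on {0..1}) (\<lambda>t. (q t)\<^sup>2)"
    using assms by (auto simp: L2_potential_def)
  have "integrable (lebesgue_on {0..1}) (\<lambda>t. 1 + (q t)\<^sup>2)"
    using q by (intro Bochner_Integration.integrable_add) auto
  then have "integrable (lebesgue_on {0..1}) q"
  proof (rule Bochner_Integration.integrable_bound[OF _ q(1)], intro AE_I2)
    fix t
    have "0 \<le> (\<bar>q t\<bar> - 1)\<^sup>2"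
      by simp
    then have "2 * \<bar>q t\<bar> \<le> 1 + (q t)\<^sup>2"
      unfolding power2_diff by simp
    then show "norm (q t) \<le> norm (1 + (q t)\<^sup>2)"
      by simp
  qed
  then show "integrable (lebesgue_on {0..1}) (\<lambda>t. \<bar>q t\<bar>)"
    by simp
qed simp

text \<open>
  Since \<open>k\<^sup>2 = - z\<close>, the function \<open>p t = exp (k t) (u' t - k u t)\<close> satisfies
  \<open>p' = exp (k t) q u\<close> almost everywhere.
\<close>

lemma schroedinger_solution_increment_bound:
  fixes k :: complex
  assumes sol: "schroedinger_solution q z u v" and k: "k\<^sup>2 = - z"
    and q: "(\<lambda>t. \<bar>q t\<bar>) integrable_on {0..1}" and t: "t \<in> {0..1}"
    and B: "\<And>s. s \<in> {0..t} \<Longrightarrow> cmod (exp (k * of_real s) * u s) \<le> B"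
  shows "cmod (exp (k * of_real t) * (v t - k * u t) - (v 0 - k * u 0))
    \<le> B * integral {0..1} (\<lambda>s. \<bar>q s\<bar>)"
proof -
  have du: "\<And>s. s \<in> {0..1} \<Longrightarrow> (u has_vector_derivative v s) (at s within {0..1})"
    and acv: "abs_continuous_on {0..1} v"
    using sol by (auto simp: schroedinger_solution_def)
  note contv = abs_continuous_on_imp_continuous_on[OF acv]
  have contu: "continuous_on {0..1} u"
    using du continuous_on_vector_derivative by blast
  have dexp: "((\<lambda>s. exp (k * of_real s)) has_vector_derivative k * exp (k * of_real s)) (at s within S)" for s S
    using exp_scaleR_has_vector_derivative_right[of k s S]
    by (simp add: scaleR_conv_of_real mult.commute)
  \<comment> \<open>Absolute continuity of \<open>p\<close> is assembled from its factors: the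
    exponential and \<open>k * u\<close> are continuously differentiable, \<open>v\<close> is
    absolutely continuous by the definition of a solution, and compactness bounds both
    factors.\<close>
  have ace: "abs_continuous_on {0..1} (\<lambda>s. exp (k * of_real s))"
    by (rule abs_continuous_on_vector_derivative[OF dexp]) (intro continuous_intros)
  have "((\<lambda>s. k * u s) has_vector_derivative k * v s) (at s within {0..1})" if "s \<in> {0..1}" for s
    using du[OF that] by (auto intro!: derivative_eq_intros)
  then have "abs_continuous_on {0..1} (\<lambda>s. k * u s)"
    by (rule abs_continuous_on_vector_derivative) (auto intro!: continuous_intros contv)
  then have acw: "abs_continuous_on {0..1} (\<lambda>s. v s - k * u s)"
    by (rule abs_continuous_on_diff[OF acv])
  define p where "p s = exp (k * of_real s) * (v s - k * u s)" for s :: real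
  have "abs_continuous_on {0..1} p"
    unfolding p_def using ace acw
    by (rule abs_continuous_on_mult)
      (intro compact_imp_bounded compact_continuous_image compact_Icc continuous_intros contu contv)+
  then have acp: "abs_continuous_on {0..t} p"
    using t by (auto elim: abs_continuous_on_subset)
  have "AE s in lebesgue. s \<in> {0..1} \<longrightarrow> (\<exists>w. (v has_vector_derivative w) (at s within {0..1}) \<and>
            - w + of_real (q s) * u s = z * u s)"
    using sol by (simp add: schroedinger_solution_def AE_restrict_space_iff)
  then obtain N where N: "N \<in> null_sets lebesgue"
    and "\<And>s. s \<in> space lebesgue - N \<Longrightarrow> s \<in> {0..1} \<longrightarrow> (\<exists>w. (v has_vector_derivative w) (at s within {0..1}) \<and>
            - w + of_real (q s) * u s = z * u s)"
    by (rule AE_E3) blast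
  then have dv: "\<exists>w. (v has_vector_derivative w) (at s within {0..1}) \<and>
            - w + of_real (q s) * u s = z * u s" if "s \<in> {0..1} - N" for s
    using that by auto
  have neg: "negligible N"
    using N by (simp add: negligible_iff_null_sets)
  define p' where "p' s = (if s \<in> N then 0 else exp (k * of_real s) * (of_real (q s) * u s))" for s
  have dp: "(p has_vector_derivative p' s) (at s within {0..t})" if s: "s \<in> {0..t} - N" for s
  proof -
    have s1: "s \<in> {0..1} - N"
      using s t by auto
    obtain w where w: "(v has_vector_derivative w) (at s within {0..1})"
      and "- w + of_real (q s) * u s = z * u s"
      using dv[OF s1] by blast
    then have weq: "w = of_real (q s) * u s + k\<^sup>2 * u s"
      unfolding k by (simp add: algebra_simps)
    have "(p has_vector_derivative exp (k * of_real s) * (w - k * v s)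
        + k * exp (k * of_real s) * (v s - k * u s)) (at s within {0..1})"
      unfolding p_def using s1
      by (intro has_vector_derivative_mult has_vector_derivative_diff dexp w
          bounded_linear.has_vector_derivative[OF bounded_linear_mult_right] du) auto
    \<comment> \<open>The terms in \<open>v\<close> cancel, and so do the terms
      \<open>k\<^sup>2 * u s\<close>; only the one containing the potential survives.\<close>
    also have "exp (k * of_real s) * (w - k * v s) + k * exp (k * of_real s) * (v s - k * u s) = p' s"
      using s by (simp add: weq p'_def algebra_simps power2_eq_square)
    finally show ?thesis
      by (rule has_vector_derivative_within_subset) (use t in auto)
  qed
  \<comment> \<open>The derivative of \<open>v\<close> is known only almost everywhere, so the
    version for absolutely continuous functions is applied.\<close>
  have FTC: "(p' has_integral (p t - p 0)) {0..t}"
    using fundamental_theorem_of_calculus_abs_continuous[OF _ acp neg dp] t by auto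
  have "0 \<le> B"
    using order_trans[OF norm_ge_zero B[of 0]] t by simp
  have sub: "(\<lambda>s. B * \<bar>q s\<bar>) integrable_on {0..t}"
    using integrable_on_cmult_left[OF integrable_on_subinterval[OF q, of 0 t], of B] t by simp
  have "cmod (p t - p 0) = cmod (integral {0..t} p')"
    using FTC by (simp add: integral_unique)
  also have "\<dots> \<le> integral {0..t} (\<lambda>s. B * \<bar>q s\<bar>)"
  proof (rule integral_norm_bound_integral[OF _ sub])
    show "p' integrable_on {0..t}"
      using FTC by blast
    fix s assume s: "s \<in> {0..t}"
    have "cmod (exp (k * of_real s) * (of_real (q s) * u s)) = cmod (exp (k * of_real s) * u s) * \<bar>q s\<bar>"
      by (simp add: norm_mult)
    also have "\<dots> \<le> B * \<bar>q s\<bar>"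
      using B[OF s] by (rule mult_right_mono) simp
    finally show "cmod (p' s) \<le> B * \<bar>q s\<bar>"
      using \<open>0 \<le> B\<close> by (simp add: p'_def)
  qed
  also have "\<dots> \<le> integral {0..1} (\<lambda>s. B * \<bar>q s\<bar>)"
    using t sub \<open>0 \<le> B\<close> integrable_on_cmult_left[OF q, of B]
    by (intro integral_subset_le) auto
  finally show ?thesis
    by (simp add: p_def)
qed

text \<open>
  The two exponential factors \<open>k = \<plusminus> \<i> z\<close> together recover \<open>u\<close>, which turns the maximum \<open>M\<close> of
  \<open>\<bar>z u t\<bar> exp (Im z t)\<close> into a self-improving bound \<open>M \<le> 1 + M Q / \<bar>z\<bar>\<close>.
\<close>

lemma schroedinger_solution_bound:
  assumes sol: "schroedinger_solution q (z\<^sup>2) u v" and init: "u 0 = 0" "v 0 = 1"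
    and q: "(\<lambda>t. \<bar>q t\<bar>) integrable_on {0..1}" and t: "t \<in> {0..1}"
    and z: "Im z \<le> 0" "z \<noteq> 0" "2 * integral {0..1} (\<lambda>s. \<bar>q s\<bar>) \<le> cmod z"
  shows "cmod (z * u t) \<le> 2 * exp (- Im z * t)"
proof -
  define Q where "Q = integral {0..1} (\<lambda>s. \<bar>q s\<bar>)"
  define m where "m s = cmod (z * u s) * exp (Im z * s)" for s
  have "continuous_on {0..1} u"
    using sol unfolding schroedinger_solution_def by (meson continuous_on_vector_derivative)
  then have "continuous_on {0..1} m"
    unfolding m_def by (intro continuous_intros)
  then obtain T where T: "T \<in> {0..1}" and max: "\<And>s. s \<in> {0..1} \<Longrightarrow> m s \<le> m T"
    using continuous_attains_sup[of "{0..1::real}" m] by auto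
  have "0 \<le> Q"
    unfolding Q_def by (rule integral_nonneg[OF q]) simp
  have "0 \<le> m T"
    by (simp add: m_def)
  have u: "cmod (u s) \<le> m T / cmod z * exp (- Im z * s)" if "s \<in> {0..1}" for s
    using max[OF that] z(2) by (simp add: m_def norm_mult exp_minus field_simps)
  \<comment> \<open>\<open>P k\<close> is the end value at the maximum point \<open>T\<close>; the
    corresponding value at 0 is 1 for every \<open>k\<close>, by the initial conditions.\<close>
  define P where "P k = exp (k * of_real T) * (v T - k * u T)" for k
  have P1: "cmod (P k - 1) \<le> b * Q"
    if "k\<^sup>2 = - (z\<^sup>2)" "\<And>s. s \<in> {0..T} \<Longrightarrow> cmod (exp (k * of_real s) * u s) \<le> b" for k b
    using schroedinger_solution_increment_bound[OF sol that(1) q T that(2)]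
    by (simp add: P_def Q_def init)
  have norm_exp_plus: "cmod (exp (\<i> * z * of_real s)) = exp (- Im z * s)"
    and norm_exp_minus: "cmod (exp (- \<i> * z * of_real s)) = exp (Im z * s)" for s
    by (simp_all add: norm_exp_eq_Re)
  have "cmod (P (\<i> * z) - 1) \<le> m T / cmod z * exp (- 2 * Im z * T) * Q"
  proof (rule P1)
    fix s assume s: "s \<in> {0..T}"
    have "cmod (exp (\<i> * z * of_real s) * u s) \<le> exp (- Im z * s) * (m T / cmod z * exp (- Im z * s))"
      unfolding norm_mult norm_exp_plus using u[of s] s T by (intro mult_left_mono) auto
    also have "\<dots> = m T / cmod z * exp (- 2 * Im z * s)"
      by (simp flip: exp_add)
    \<comment> \<open>As \<open>Im z \<le> 0\<close>, the exponential is nondecreasing in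
      \<open>s\<close>.\<close>
    also have "\<dots> \<le> m T / cmod z * exp (- 2 * Im z * T)"
      using s z \<open>0 \<le> m T\<close> by (intro mult_left_mono) (auto intro: mult_left_mono_neg)
    finally show "cmod (exp (\<i> * z * of_real s) * u s) \<le> m T / cmod z * exp (- 2 * Im z * T)" .
  qed (simp add: power_mult_distrib)
  then have plus: "cmod (P (\<i> * z)) \<le> 1 + m T / cmod z * exp (- 2 * Im z * T) * Q"
    using norm_triangle_ineq[of "P (\<i> * z) - 1" 1] by simp
  have "cmod (P (- \<i> * z) - 1) \<le> m T / cmod z * Q"
  proof (rule P1)
    fix s assume s: "s \<in> {0..T}"
    have "cmod (exp (- \<i> * z * of_real s) * u s) \<le> exp (Im z * s) * (m T / cmod z * exp (- Im z * s))"
      unfolding norm_mult[of "exp _"] norm_exp_minus using u[of s] s T by (intro mult_left_mono) auto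
    also have "\<dots> = m T / cmod z"
      by (simp add: exp_minus_inverse flip: exp_add)
    finally show "cmod (exp (- \<i> * z * of_real s) * u s) \<le> m T / cmod z" .
  qed (simp add: power_mult_distrib)
  then have minus: "cmod (P (- \<i> * z)) \<le> 1 + m T / cmod z * Q"
    using norm_triangle_ineq[of "P (- \<i> * z) - 1" 1] by simp
  have "exp (- \<i> * z * of_real T) * exp (\<i> * z * of_real T) = 1"
    by (simp flip: exp_add)
  \<comment> \<open>The two first-order expressions \<open>v T - \<i> * z * u T\<close> and
    \<open>v T + \<i> * z * u T\<close> are subtracted, which eliminates \<open>v T\<close>.\<close>
  then have "2 * \<i> * (z * u T) = exp (\<i> * z * of_real T) * P (- \<i> * z) - exp (- \<i> * z * of_real T) * P (\<i> * z)"
    unfolding P_def by algebra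
  then have "2 * cmod (z * u T) = cmod (exp (\<i> * z * of_real T) * P (- \<i> * z) - exp (- \<i> * z * of_real T) * P (\<i> * z))"
    by (metis norm_mult norm_ii norm_numeral mult_1_right)
  also have "\<dots> \<le> exp (- Im z * T) * cmod (P (- \<i> * z)) + exp (Im z * T) * cmod (P (\<i> * z))"
    using norm_triangle_ineq4 unfolding norm_exp_plus[symmetric] norm_exp_minus[symmetric] norm_mult[symmetric] .
  finally have "2 * m T \<le> exp (Im z * T) *
      (exp (- Im z * T) * cmod (P (- \<i> * z)) + exp (Im z * T) * cmod (P (\<i> * z)))"
    by (simp add: m_def)
  also have "\<dots> = cmod (P (- \<i> * z)) + exp (2 * Im z * T) * cmod (P (\<i> * z))"
    by (simp add: distrib_left mult.assoc[symmetric] flip: exp_add)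
  also have "\<dots> \<le> (1 + m T / cmod z * Q) + exp (2 * Im z * T) * (1 + m T / cmod z * exp (- 2 * Im z * T) * Q)"
    using minus plus by (intro add_mono mult_left_mono) auto
  also have "\<dots> = 1 + exp (2 * Im z * T) + 2 * (m T / cmod z * Q)"
    by (simp add: exp_minus field_simps)
  also have "\<dots> \<le> 2 + 2 * (m T / cmod z * Q)"
    using z(1) T by (simp add: mult_nonpos_nonneg)
  also have "m T / cmod z * Q = m T * (Q / cmod z)"
    by simp
  \<comment> \<open>The lower bound on \<open>cmod z\<close> makes the coefficient at most 1/2. The
    inequality becomes \<open>2 * m T \<le> 2 + m T\<close>, and the maximum is absorbed on the
    left.\<close>
  also have "m T * (Q / cmod z) \<le> m T * (1 / 2)"
    using z \<open>0 \<le> m T\<close> by (intro mult_left_mono) (auto simp: field_simps Q_def)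
  finally have "m T \<le> 2"
    by simp
  then have "m t \<le> 2"
    using max[OF t] by simp
  then show ?thesis
    by (simp add: m_def exp_minus field_simps)
qed

text \<open>A zero of \<open>E z = \<i> (v 1 - \<i> z u 1)\<close> forces the increment of \<open>exp (\<i> z t) (v t - \<i> z u t)\<close>
  over \<open>[0,1]\<close> to be \<open>- 1\<close>.\<close>

lemma schroedinger_zero_bound:
  assumes sol: "schroedinger_solution q (z\<^sup>2) u v" and init: "u 0 = 0" "v 0 = 1"
    and q: "(\<lambda>t. \<bar>q t\<bar>) integrable_on {0..1}"
    and z: "Im z \<le> 0" "z * u 1 + \<i> * v 1 = 0"
  shows "cmod z \<le> 2 * integral {0..1} (\<lambda>s. \<bar>q s\<bar>) * exp (- 2 * Im z)"
proof -
  define Q where "Q = integral {0..1} (\<lambda>s. \<bar>q s\<bar>)"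
  have "0 \<le> Q"
    unfolding Q_def by (rule integral_nonneg[OF q]) simp
  show ?thesis
  \<comment> \<open>The bound on the solution requires \<open>2 * Q \<le> cmod z\<close> and
    \<open>z \<noteq> 0\<close>. Otherwise \<open>cmod z \<le> 2 * Q\<close>, and the claim follows
    from \<open>1 \<le> exp (- 2 * Im z)\<close>.\<close>
  proof (cases "2 * Q \<le> cmod z \<and> z \<noteq> 0")
    case True
    have "v 1 - \<i> * z * u 1 = - \<i> * (z * u 1 + \<i> * v 1)"
      by (simp add: algebra_simps)
    then have v1: "v 1 - \<i> * z * u 1 = 0"
      using z(2) by simp
    have "cmod (exp (\<i> * z * of_real s) * u s) \<le> 2 * exp (- 2 * Im z) / cmod z" if s: "s \<in> {0..1}" for s
    proof -
      have "cmod z * cmod (exp (\<i> * z * of_real s) * u s) = exp (- Im z * s) * cmod (z * u s)"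
        by (simp add: norm_mult norm_exp_eq_Re)
      also have "\<dots> \<le> exp (- Im z * s) * (2 * exp (- Im z * s))"
        using schroedinger_solution_bound[OF sol init q s z(1)] True
        by (intro mult_left_mono) (auto simp: Q_def)
      also have "\<dots> = 2 * exp (- 2 * Im z * s)"
        by (simp flip: exp_add)
      also have "\<dots> \<le> 2 * exp (- 2 * Im z)"
        using s z(1) mult_left_mono_neg[of s 1 "Im z"] by simp
      finally show ?thesis
        using True by (simp add: field_simps)
    qed
    then have "cmod (exp (\<i> * z * of_real 1) * (v 1 - \<i> * z * u 1) - (v 0 - \<i> * z * u 0))
        \<le> 2 * exp (- 2 * Im z) / cmod z * Q"
      unfolding Q_def using sol q
      by (intro schroedinger_solution_increment_bound) (auto simp: power_mult_distrib)
    then have "1 \<le> 2 * exp (- 2 * Im z) / cmod z * Q"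
      using v1 init by simp
    then show ?thesis
      using True by (simp add: field_simps flip: Q_def)
  next
    case False
    have "2 * Q * 1 \<le> 2 * Q * exp (- 2 * Im z)"
      using \<open>0 \<le> Q\<close> z(1) by (intro mult_left_mono) auto
    moreover have "cmod z \<le> 2 * Q"
      using False \<open>0 \<le> Q\<close> by auto
    ultimately show ?thesis
      by (simp flip: Q_def)
  qed
qed

section \<open>Finiteness of the zeros in the logarithmic strip\<close>

theorem theorem4:
  fixes E :: "complex \<Rightarrow> complex" and q :: "real \<Rightarrow> real"
  assumes "hermite_biehler E"
    and "L2_potential q"
    and "positive_schroedinger_operator q dirichlet_dirichlet"
    and "positive_schroedinger_operator q dirichlet_neumann"
    and "corresponds_to_potential E q"
  shows "\<exists>C>0. finite {z. Im z < 0 \<and>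
            - (1/2) * ln (\<bar>Re z\<bar> + 2) + C \<le> Im z \<and> E z = 0}"
proof -
  define Q where "Q = integral {0..1} (\<lambda>s. \<bar>q s\<bar>)"
  have q: "(\<lambda>t. \<bar>q t\<bar>) integrable_on {0..1}"
    using L2_potential_imp_abs_integrable_on[OF assms(2)] .
  have "0 \<le> Q"
    unfolding Q_def by (rule integral_nonneg[OF q]) simp
  \<comment> \<open>The factor \<open>4 * Q\<close> yields
    \<open>2 * Q / (4 * Q + 2) \<le> 1 / 2\<close> below, and the summand 2 makes \<open>C\<close>
    positive even if \<open>Q = 0\<close>.\<close>
  define C where "C = ln (4 * Q + 2) / 2"
  have "0 < C"
    using \<open>0 \<le> Q\<close> by (simp add: C_def)
  let ?Z = "{z. Im z < 0 \<and> - (1/2) * ln (\<bar>Re z\<bar> + 2) + C \<le> Im z \<and> E z = 0}"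
  have "?Z \<subseteq> {z \<in> cball 0 2. E z = 0}"
  proof
    fix z assume "z \<in> ?Z"
    then have z: "Im z < 0" "- (1/2) * ln (\<bar>Re z\<bar> + 2) + C \<le> Im z" "E z = 0"
      by auto
    have "cmod z \<le> 2 * Q * exp (- 2 * Im z)"
      using assms(5) schroedinger_zero_bound[OF _ _ _ q] z(1,3)
      unfolding corresponds_to_potential_def Q_def by (metis less_imp_le)
    also have "\<dots> \<le> 2 * Q * ((\<bar>Re z\<bar> + 2) / (4 * Q + 2))"
    proof (rule mult_left_mono)
      have "exp (- 2 * Im z) \<le> exp (ln (\<bar>Re z\<bar> + 2) - ln (4 * Q + 2))"
        using z(2) by (simp add: C_def field_simps)
      also have "\<dots> = (\<bar>Re z\<bar> + 2) / (4 * Q + 2)"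
        using \<open>0 \<le> Q\<close> by (simp add: exp_diff)
      finally show "exp (- 2 * Im z) \<le> (\<bar>Re z\<bar> + 2) / (4 * Q + 2)" .
    qed (use \<open>0 \<le> Q\<close> in simp)
    also have "\<dots> \<le> (\<bar>Re z\<bar> + 2) / 2"
      using \<open>0 \<le> Q\<close> by (simp add: field_simps)
    \<comment> \<open>From \<open>cmod z \<le> (\<bar>Re z\<bar> + 2) / 2\<close> and
      \<open>\<bar>Re z\<bar> \<le> cmod z\<close>, half of \<open>cmod z\<close> is absorbed on the
      left.\<close>
    finally have "cmod z \<le> 2"
      using abs_Re_le_cmod[of z] by simp
    then show "z \<in> {z \<in> cball 0 2. E z = 0}"
      using z(3) by simp
  qed
  moreover have "finite {z \<in> cball 0 2. E z = 0}"
  \<comment> \<open>A nonconstant entire function has finitely many zeros in a compact set; a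
    constant \<open>E\<close> has none, since it does not vanish at the real point 0.\<close>
  proof (cases "E constant_on UNIV")
    case True
    then obtain c where "\<And>z. E z = c"
      unfolding constant_on_def by auto
    moreover have "E (of_real 0) \<noteq> 0"
      using assms(1) unfolding hermite_biehler_def by blast
    ultimately show ?thesis
      by simp
  next
    case False
    then show ?thesis
      using assms(1) by (intro holomorphic_compact_finite_zeros[of E UNIV]) (auto simp: hermite_biehler_def)
  qed
  ultimately have "finite ?Z"
    by (rule finite_subset)
  with \<open>0 < C\<close> show ?thesis
    by blast
qed

end
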